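(* Let $A$ be an $n\times n$ normal matrix of rank $r\le n$ with an eigenvector matrix $V$ and polar factor $P$, and let $E$ be an $n\times n$ matrix. Let $D$ be an invertible $n\times n$ matrix such that $D^{*}D$ commutes with $V_rV_r^{*}$. If $\tilde A$ is a normal matrix with polar factor $\tilde P=DPD^{*}$, and $\tilde E=DED^{*}$, then $$\|(A^{1/2})^{+}E(A^{1/2})^{+}\|=\|(\tilde A^{1/2})^{+}\tilde E(\tilde A^{1/2})^{+}\|.$$
   Context: All matrices are complex. $\|\cdot\|$ is the matrix 2-norm (largest singular value), $X^{*}$ the conjugate transpose, and $X^{+}$ the Moore-Penrose pseudo-inverse. The eigenvector matrix $V$ is a unitary matrix giving a spectral decomposition $A=V\Lambda V^{*}$ whose diagonal lists the $r$ nonzero eigenvalues first, followed by $n-r$ zeros; $V_r$ is the $n\times r$ matrix of the first $r$ columns of $V$ (eigenvectors for nonzero eigenvalues). The polar factor of a normal matrix $A$ is the positive semi-definite matrix $P=(A^{*}A)^{1/2}=V|\Lambda|V^{*}$. For a normal matrix $A=V\,\mathrm{diag}(\lambda_1,\dots,\lambda_n)V^{*}$, $A^{1/2}$ denotes any normal square root $V\,\mathrm{diag}(\lambda_1^{1/2},\dots,\lambda_n^{1/2})V^{*}$, with $\lambda_j^{1/2}$ a complex square root of $\lambda_j$. *)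

theory Defs
  imports
    Jordan_Normal_Form.Schur_Decomposition
    Jordan_Normal_Form.DL_Rank
begin

text \<open>The conjugate transpose is \<^const>\<open>mat_adjoint\<close>.\<close>

lemma mat_adjoint_carrier:
  "A \<in> carrier_mat m n \<Longrightarrow> mat_adjoint A \<in> carrier_mat n m"
  unfolding mat_adjoint_def by auto

lemma mat_adjoint_index:
  assumes "i < dim_col A" "j < dim_row A"
  shows "mat_adjoint A $$ (i, j) = conjugate (A $$ (j, i))"
  using assms unfolding mat_adjoint_def by (simp add: mat_of_rows_index)

lemma mat_adjoint_mult:
  fixes A B :: "complex mat"
  assumes A: "A \<in> carrier_mat m n" and B: "B \<in> carrier_mat n k"
  shows "mat_adjoint (A * B) = mat_adjoint B * mat_adjoint A"
proof (rule eq_matI)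
  show "dim_row (mat_adjoint (A * B)) = dim_row (mat_adjoint B * mat_adjoint A)"
    "dim_col (mat_adjoint (A * B)) = dim_col (mat_adjoint B * mat_adjoint A)"
    using assms by (auto simp: mat_adjoint_def)
next
  fix i j
  assume "i < dim_row (mat_adjoint B * mat_adjoint A)"
    and "j < dim_col (mat_adjoint B * mat_adjoint A)"
  then have i: "i < k" and j: "j < m"
    using assms by (auto simp: mat_adjoint_def)
  have "mat_adjoint (A * B) $$ (i, j) = (\<Sum>l = 0..<n. cnj (A $$ (j, l)) * cnj (B $$ (l, i)))"
    using i j assms by (simp add: mat_adjoint_index scalar_prod_def)
  also have "\<dots> = (mat_adjoint B * mat_adjoint A) $$ (i, j)"
    using i j assms mat_adjoint_carrier[OF A] mat_adjoint_carrier[OF B]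
    by (simp add: mat_adjoint_index scalar_prod_def mult.commute)
  finally show "mat_adjoint (A * B) $$ (i, j) = (mat_adjoint B * mat_adjoint A) $$ (i, j)" .
qed

definition normal_mat :: "complex mat \<Rightarrow> bool" where
  "normal_mat A \<longleftrightarrow> square_mat A \<and> A * mat_adjoint A = mat_adjoint A * A"

definition unitary_mat :: "complex mat \<Rightarrow> bool" where
  "unitary_mat U \<longleftrightarrow> square_mat U \<and>
     U * mat_adjoint U = 1\<^sub>m (dim_row U) \<and> mat_adjoint U * U = 1\<^sub>m (dim_row U)"

definition pos_semidef_mat :: "complex mat \<Rightarrow> bool" where
  "pos_semidef_mat P \<longleftrightarrow> square_mat P \<and> mat_adjoint P = P \<and>
     (\<forall>v \<in> carrier_vec (dim_row P). 0 \<le> Re ((P *\<^sub>v v) \<bullet>c v))"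

definition singular_values :: "complex mat \<Rightarrow> real set" where
  "singular_values A =
     {s. 0 \<le> s \<and> eigenvalue (mat_adjoint A * A) (complex_of_real (s\<^sup>2))}"

text \<open>For a matrix without columns the set of singular values is empty and the norm
  below is unspecified.\<close>

definition norm2_mat :: "complex mat \<Rightarrow> real" where
  "norm2_mat A = Max (singular_values A)"

text \<open>The four Penrose conditions.\<close>

definition is_pinv :: "complex mat \<Rightarrow> complex mat \<Rightarrow> bool" where
  "is_pinv A X \<longleftrightarrow> X \<in> carrier_mat (dim_col A) (dim_row A) \<and>
     A * X * A = A \<and> X * A * X = X \<and>
     mat_adjoint (A * X) = A * X \<and> mat_adjoint (X * A) = X * A"

lemma is_pinv_unique:
  assumes X: "is_pinv A X" and Y: "is_pinv A Y"
  shows "X = Y"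
proof -
  define m n where "m = dim_row A" and "n = dim_col A"
  have A: "A \<in> carrier_mat m n" by (auto simp: m_def n_def)
  have Xc: "X \<in> carrier_mat n m" and Yc: "Y \<in> carrier_mat n m"
    using X Y by (auto simp: is_pinv_def m_def n_def)
  have x: "A * X * A = A" "X * A * X = X"
      "mat_adjoint (A * X) = A * X" "mat_adjoint (X * A) = X * A"
    and y: "A * Y * A = A" "Y * A * Y = Y"
      "mat_adjoint (A * Y) = A * Y" "mat_adjoint (Y * A) = Y * A"
    using X Y by (auto simp: is_pinv_def)
  have AX: "A * X \<in> carrier_mat m m" and AY: "A * Y \<in> carrier_mat m m"
    and XA: "X * A \<in> carrier_mat n n" and YA: "Y * A \<in> carrier_mat n n"
    using A Xc Yc by auto
  have "A * X = (A * Y) * (A * X)"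
    using y(1) assoc_mult_mat[OF AY A Xc] by simp
  then have "A * X = mat_adjoint ((A * Y) * (A * X))"
    using x(3) by simp
  also have "\<dots> = (A * X) * (A * Y)"
    by (simp add: mat_adjoint_mult[OF AY AX] x(3) y(3))
  also have "\<dots> = A * Y"
    using x(1) assoc_mult_mat[OF AX A Yc] by simp
  finally have 1: "A * X = A * Y" .
  have "X * A = (X * A) * (Y * A)"
    using y(1) assoc_mult_mat[OF Xc A YA] assoc_mult_mat[OF A Yc A] by simp
  then have "X * A = mat_adjoint ((X * A) * (Y * A))"
    using x(4) by simp
  also have "\<dots> = (Y * A) * (X * A)"
    by (simp add: mat_adjoint_mult[OF XA YA] x(4) y(4))
  also have "\<dots> = Y * A"
    using x(1) assoc_mult_mat[OF Yc A XA] assoc_mult_mat[OF A Xc A] by simp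
  finally have 2: "X * A = Y * A" .
  have "X = X * (A * X)" using x(2) assoc_mult_mat[OF Xc A Xc] by simp
  also have "\<dots> = Y * A * Y" using 1 2 assoc_mult_mat[OF Xc A Yc] by simp
  finally show "X = Y" using y(2) by simp
qed

definition pinv :: "complex mat \<Rightarrow> complex mat" where
  "pinv A = (THE X. is_pinv A X)"

definition is_eigenvector_matrix :: "complex mat \<Rightarrow> nat \<Rightarrow> complex mat \<Rightarrow> bool" where
  "is_eigenvector_matrix A r V \<longleftrightarrow>
     unitary_mat V \<and>
     (\<exists>l. A = V * mat_diag (dim_row V) l * mat_adjoint V \<and>
        (\<forall>i < dim_row V. l i \<noteq> 0 \<longleftrightarrow> i < r))"

definition first_cols :: "nat \<Rightarrow> complex mat \<Rightarrow> complex mat" where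
  "first_cols r V = mat_of_cols (dim_row V) (take r (cols V))"

text \<open>\<open>P\<close> is the positive semi-definite square root of \<open>A\<^sup>* A\<close>.\<close>

definition is_polar_factor :: "complex mat \<Rightarrow> complex mat \<Rightarrow> bool" where
  "is_polar_factor A P \<longleftrightarrow> pos_semidef_mat P \<and> P * P = mat_adjoint A * A"

text \<open>A normal matrix usually has several normal square roots: each root \<open>m i\<close> of the
  eigenvalue \<open>l i\<close> is chosen independently, and \<open>V\<close> may be any unitary matrix
  diagonalising \<open>A\<close>.\<close>

definition is_normal_sqrt :: "complex mat \<Rightarrow> complex mat \<Rightarrow> bool" where
  "is_normal_sqrt A S \<longleftrightarrow>
     (\<exists>V l m. unitary_mat V \<and>
        A = V * mat_diag (dim_row V) l * mat_adjoint V \<and>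
        S = V * mat_diag (dim_row V) m * mat_adjoint V \<and>
        (\<forall>i < dim_row V. (m i)\<^sup>2 = l i))"

end

theory Submission
  imports Defs
begin

text \<open>Write \<open>X = S\<^sup>+\<close> and \<open>G = X X\<^sup>*\<close>. The square root \<open>S\<close> is a normal matrix whose
  eigenvalues have squared moduli \<open>\<bar>\<lambda>\<bar>\<close>, so \<open>G = X\<^sup>* X\<close>, and \<open>G\<close> is the pseudo-inverse
  of the polar factor \<open>P\<close>; in particular \<open>G\<close> does not depend on which root was chosen
  (\<open>pinv_normal_sqrt_square\<close>).

  The squared singular values of \<open>X E X\<close> are the eigenvalues of
  \<open>X\<^sup>* E\<^sup>* X\<^sup>* X E X = X\<^sup>* E\<^sup>* G E X\<close>. Moving the last factor to the front does not change
  the eigenvalues, so they are the eigenvalues of \<open>G E\<^sup>* G E\<close>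
  (\<open>singular_values_sandwich\<close>). The norm is thus a function of \<open>P\<close> and \<open>E\<close> alone.

  It remains to compare the two sides. The product \<open>P G\<close> is the orthogonal projector
  \<open>V\<^sub>r V\<^sub>r\<^sup>*\<close>, and a congruence by \<open>D\<close> turns \<open>G\<close> into \<open>G' = D\<^sup>-\<^sup>* G D\<^sup>-\<^sup>1\<close> as soon as
  \<open>D\<^sup>* D\<close> commutes with that projector (\<open>is_pinv_congruence\<close>). Then \<open>D\<^sup>* G' D = G\<close>, and moving
  the last factor \<open>D\<^sup>*\<close> of
  \<open>G' E'\<^sup>* G' E' = G' D E\<^sup>* D\<^sup>* G' D E D\<^sup>*\<close> to the front gives \<open>G E\<^sup>* G E\<close>. All singular
  values agree, hence also the largest ones.\<close>

section \<open>Conjugate transposes\<close>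

lemma mat_adjoint_dim [simp]:
  "dim_row (mat_adjoint A) = dim_col A" "dim_col (mat_adjoint A) = dim_row A"
  by (auto simp: mat_adjoint_def)

lemma mat_adjoint_mat_adjoint [simp]:
  fixes A :: "complex mat"
  shows "mat_adjoint (mat_adjoint A) = A"
  by (rule eq_matI) (auto simp: mat_adjoint_index)

lemma mat_adjoint_one [simp]: "mat_adjoint (1\<^sub>m n :: complex mat) = 1\<^sub>m n"
  by (rule eq_matI) (auto simp: mat_adjoint_index)

lemma mat_adjoint_mat_diag [simp]:
  fixes l :: "nat \<Rightarrow> complex"
  shows "mat_adjoint (mat_diag n l) = mat_diag n (\<lambda>i. cnj (l i))"
  by (rule eq_matI) (auto simp: mat_adjoint_index mat_diag_def)

lemma unitary_matD:
  assumes "unitary_mat U" "dim_row U = n"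
  shows "U \<in> carrier_mat n n" "U * mat_adjoint U = 1\<^sub>m n" "mat_adjoint U * U = 1\<^sub>m n"
  using assms by (auto simp: unitary_mat_def square_mat.simps)

section \<open>Unitarily diagonalised matrices\<close>

text \<open>The three decompositions in play (eigenvector matrix, normal square root, polar factor)
  all have this shape, and for fixed \<open>U\<close> their products, adjoints and pseudo-inverses are
  computed entry by entry on the diagonal.\<close>

definition unitary_diag :: "complex mat \<Rightarrow> (nat \<Rightarrow> complex) \<Rightarrow> complex mat" where
  "unitary_diag U l = U * mat_diag (dim_row U) l * mat_adjoint U"

lemma unitary_diag_carrier:
  assumes "unitary_mat U" "dim_row U = n"
  shows "unitary_diag U l \<in> carrier_mat n n"
  using unitary_matD[OF assms] assms(2) unfolding unitary_diag_def
  by (intro mult_carrier_mat[of _ n n]) (auto simp: mat_adjoint_carrier)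

lemma unitary_diag_mult:
  assumes U: "unitary_mat U"
  shows "unitary_diag U l * unitary_diag U m = unitary_diag U (\<lambda>i. l i * m i)"
proof -
  define n where "n = dim_row U"
  note c = unitary_matD[OF U n_def[symmetric]]
  have a: "mat_adjoint U \<in> carrier_mat n n" using c(1) by (rule mat_adjoint_carrier)
  note assoc = assoc_mult_mat[where ?n\<^sub>1.0 = n and ?n\<^sub>2.0 = n and ?n\<^sub>3.0 = n and ?n\<^sub>4.0 = n]
  note carr = mult_carrier_mat[where nr = n and n = n and nc = n]
  let ?l = "mat_diag n l" and ?m = "mat_diag n m"
  have "unitary_diag U l * unitary_diag U m =
      U * (?l * ((mat_adjoint U * U) * (?m * mat_adjoint U)))"
    unfolding unitary_diag_def n_def[symmetric] using c(1) a by (simp add: assoc carr)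
  also have "\<dots> = U * ((?l * ?m) * mat_adjoint U)"
    unfolding c(3) using a
    by (simp add: assoc[OF mat_diag_dim mat_diag_dim a]
        left_mult_one_mat[OF mult_carrier_mat[OF mat_diag_dim a]] del: mat_diag_diag)
  also have "\<dots> = unitary_diag U (\<lambda>i. l i * m i)"
    unfolding unitary_diag_def n_def[symmetric] using c(1) a by (simp add: assoc carr)
  finally show ?thesis .
qed

lemma unitary_diag_adjoint:
  assumes U: "unitary_mat U"
  shows "mat_adjoint (unitary_diag U l) = unitary_diag U (\<lambda>i. cnj (l i))"
proof -
  define n where "n = dim_row U"
  note c = unitary_matD[OF U n_def[symmetric]]
  have a: "mat_adjoint U \<in> carrier_mat n n" using c(1) by (rule mat_adjoint_carrier)
  have "mat_adjoint (unitary_diag U l) = U * (mat_diag n (\<lambda>i. cnj (l i)) * mat_adjoint U)"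
    unfolding unitary_diag_def n_def[symmetric]
    using c(1) a by (simp add: mat_adjoint_mult[of _ n n _ n] mult_carrier_mat[of _ n n _ n])
  then show ?thesis
    unfolding unitary_diag_def n_def[symmetric]
    using assoc_mult_mat[OF c(1) mat_diag_dim a] by simp
qed

lemma unitary_diag_cong:
  assumes "\<And>i. i < dim_row U \<Longrightarrow> l i = m i"
  shows "unitary_diag U l = unitary_diag U m"
proof -
  have "mat_diag (dim_row U) l = mat_diag (dim_row U) m"
    using assms by (auto simp: mat_diag_def intro!: eq_matI)
  then show ?thesis by (simp add: unitary_diag_def)
qed

lemma unitary_diag_mult_col:
  assumes U: "unitary_mat U" and j: "j < dim_row U"
  shows "unitary_diag U l *\<^sub>v col U j = l j \<cdot>\<^sub>v col U j"
proof -
  define n where "n = dim_row U"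
  note c = unitary_matD[OF U n_def[symmetric]]
  have a: "mat_adjoint U \<in> carrier_mat n n" using c(1) by (rule mat_adjoint_carrier)
  have "unitary_diag U l * U = U * mat_diag n l * (mat_adjoint U * U)"
    unfolding unitary_diag_def n_def[symmetric]
    by (rule assoc_mult_mat[OF mult_carrier_mat[OF c(1) mat_diag_dim] a c(1)])
  also have "\<dots> = U * mat_diag n l"
    unfolding c(3) by (rule right_mult_one_mat[OF mult_carrier_mat[OF c(1) mat_diag_dim]])
  finally have "unitary_diag U l * U = U * mat_diag n l" .
  moreover have "col (unitary_diag U l * U) j = unitary_diag U l *\<^sub>v col U j"
    by (rule col_mult2[OF unitary_diag_carrier[OF U n_def[symmetric]] c(1) j[folded n_def]])
  moreover have "col (U * mat_diag n l) j = l j \<cdot>\<^sub>v col U j"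
    unfolding mat_diag_mult_right[OF c(1)]
    using c(1) j[folded n_def] by (intro eq_vecI) (simp_all add: mult.commute)
  ultimately show ?thesis by simp
qed

text \<open>The columns of a unitary matrix form a basis, so knowing that they are eigenvectors
  determines the matrix.\<close>

lemma eq_unitary_diagI:
  assumes U: "unitary_mat U" and P: "P \<in> carrier_mat (dim_row U) (dim_row U)"
    and eig: "\<And>j. j < dim_row U \<Longrightarrow> P *\<^sub>v col U j = l j \<cdot>\<^sub>v col U j"
  shows "P = unitary_diag U l"
proof -
  define n where "n = dim_row U"
  note c = unitary_matD[OF U n_def[symmetric]]
  have a: "mat_adjoint U \<in> carrier_mat n n" using c(1) by (rule mat_adjoint_carrier)
  have Pc: "P \<in> carrier_mat n n" using P n_def by simp
  note Dc = unitary_diag_carrier[OF U n_def[symmetric], of l]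
  have "P * U = unitary_diag U l * U"
  proof (rule mat_col_eqI)
    fix j assume "j < dim_col (unitary_diag U l * U)"
    then have j: "j < n" using c(1) by simp
    have "col (P * U) j = P *\<^sub>v col U j" using Pc c(1) j by (intro col_mult2) auto
    also have "\<dots> = unitary_diag U l *\<^sub>v col U j"
      using eig unitary_diag_mult_col[OF U] j n_def by simp
    also have "\<dots> = col (unitary_diag U l * U) j"
      using Dc c(1) j by (intro col_mult2[symmetric]) auto
    finally show "col (P * U) j = col (unitary_diag U l * U) j" .
  qed (use Pc Dc c(1) in auto)
  then have "P * U * mat_adjoint U = unitary_diag U l * U * mat_adjoint U" by simp
  then show ?thesis
    using Pc Dc by (simp add: assoc_mult_mat[OF _ c(1) a] c(2))
qed

text \<open>The convention \<open>inverse 0 = 0\<close> is exactly what the Penrose conditions ask for at a zero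
  eigenvalue.\<close>

lemma is_pinv_unitary_diag:
  assumes U: "unitary_mat U"
  shows "is_pinv (unitary_diag U l) (unitary_diag U (\<lambda>i. inverse (l i)))"
proof -
  have id: "l i * inverse (l i) * l i = l i" "inverse (l i) * l i * inverse (l i) = inverse (l i)"
    "cnj (l i * inverse (l i)) = l i * inverse (l i)"
    "cnj (inverse (l i) * l i) = inverse (l i) * l i" for i
    by (cases "l i = 0"; simp)+
  have "unitary_diag U l \<in> carrier_mat (dim_row U) (dim_row U)"
    and "unitary_diag U (\<lambda>i. inverse (l i)) \<in> carrier_mat (dim_row U) (dim_row U)"
    by (rule unitary_diag_carrier[OF U refl])+
  then show ?thesis
    unfolding is_pinv_def unitary_diag_mult[OF U] unitary_diag_adjoint[OF U] id by simp
qed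

lemma pinv_eqI:
  assumes "is_pinv A X"
  shows "pinv A = X"
  unfolding pinv_def using assms is_pinv_unique by blast

text \<open>This puts the projector onto the first columns into the diagonalised form, where it can be
  recognised as \<open>A A\<^sup>+\<close>.\<close>

lemma first_cols_mult_adjoint:
  assumes U: "unitary_mat U" and r: "r \<le> dim_row U"
  shows "first_cols r U * mat_adjoint (first_cols r U) =
    unitary_diag U (\<lambda>i. if i < r then 1 else 0)"
proof -
  define n where "n = dim_row U"
  note c = unitary_matD[OF U n_def[symmetric]]
  have a: "mat_adjoint U \<in> carrier_mat n n" using c(1) by (rule mat_adjoint_carrier)
  have rn: "r \<le> n" using r n_def by simp
  have F: "first_cols r U \<in> carrier_mat n r"
    using c(1) rn by (auto simp: first_cols_def)
  have Fi: "first_cols r U $$ (i, j) = U $$ (i, j)" if "i < n" "j < r" for i j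
    using that c(1) rn by (simp add: first_cols_def mat_of_cols_index)
  show ?thesis
  proof (rule eq_matI)
    fix i j assume "i < dim_row (unitary_diag U (\<lambda>i. if i < r then 1 else 0))"
      "j < dim_col (unitary_diag U (\<lambda>i. if i < r then 1 else 0))"
    then have ij: "i < n" "j < n"
      using unitary_diag_carrier[OF U n_def[symmetric], of "\<lambda>i. if i < r then 1 else 0"] by auto
    have "(first_cols r U * mat_adjoint (first_cols r U)) $$ (i, j) =
        (\<Sum>k = 0..<r. U $$ (i, k) * cnj (U $$ (j, k)))"
      using F ij Fi by (simp add: scalar_prod_def mat_adjoint_index)
    also have "\<dots> = (\<Sum>k = 0..<n. if k < r then U $$ (i, k) * cnj (U $$ (j, k)) else 0)"
      using rn by (intro sum.mono_neutral_cong_left) auto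
    also have "\<dots> = unitary_diag U (\<lambda>i. if i < r then 1 else 0) $$ (i, j)"
      unfolding unitary_diag_def n_def[symmetric]
      using ij c(1) a
      by (auto simp: mat_diag_mult_right[OF c(1)] scalar_prod_def mat_adjoint_index intro!: sum.cong)
    finally show "(first_cols r U * mat_adjoint (first_cols r U)) $$ (i, j) =
      unitary_diag U (\<lambda>i. if i < r then 1 else 0) $$ (i, j)" .
  qed (use F unitary_diag_carrier[OF U n_def[symmetric], of "\<lambda>i. if i < r then 1 else 0"] in auto)
qed

section \<open>Positive semi-definite square roots\<close>

lemma cscalar_prod_mult_mat_vec:
  fixes A :: "complex mat"
  assumes A: "A \<in> carrier_mat n n" and v: "v \<in> carrier_vec n" and w: "w \<in> carrier_vec n"
  shows "(A *\<^sub>v v) \<bullet>c w = v \<bullet>c (mat_adjoint A *\<^sub>v w)"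
proof -
  have "(A *\<^sub>v v) \<bullet>c w = (\<Sum>i = 0..<n. \<Sum>j = 0..<n. A $$ (i, j) * v $ j * cnj (w $ i))"
    using assms by (simp add: scalar_prod_def sum_distrib_right)
  also have "\<dots> = (\<Sum>j = 0..<n. \<Sum>i = 0..<n. A $$ (i, j) * v $ j * cnj (w $ i))"
    by (rule sum.swap)
  also have "\<dots> = v \<bullet>c (mat_adjoint A *\<^sub>v w)"
    using assms
    by (simp add: scalar_prod_def sum_distrib_left mat_adjoint_index mult_ac)
  finally show ?thesis .
qed

text \<open>For \<open>q > 0\<close> the vector \<open>u = P w - q w\<close> satisfies \<open>P u = - q u\<close>, since
  \<open>(P + q) (P - q) w = 0\<close>; positivity of \<open>P\<close> then forces \<open>u = 0\<close>. For \<open>q = 0\<close>, \<open>P\<close> being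
  Hermitian, the squared norm of \<open>P w\<close> is \<open>w\<^sup>* P\<^sup>2 w = 0\<close>.\<close>

lemma pos_semidef_eigenvector_of_square:
  assumes P: "pos_semidef_mat P" and Pc: "P \<in> carrier_mat n n"
    and w: "w \<in> carrier_vec n" and q: "0 \<le> (q :: real)"
    and eig: "(P * P) *\<^sub>v w = complex_of_real (q\<^sup>2) \<cdot>\<^sub>v w"
  shows "P *\<^sub>v w = complex_of_real q \<cdot>\<^sub>v w"
proof (cases "q = 0")
  case True
  have Pw: "P *\<^sub>v w \<in> carrier_vec n" using Pc w by simp
  have "(P *\<^sub>v w) \<bullet>c (P *\<^sub>v w) = w \<bullet>c (P *\<^sub>v (P *\<^sub>v w))"
    using cscalar_prod_mult_mat_vec[OF Pc w Pw] P by (simp add: pos_semidef_mat_def)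
  also have "P *\<^sub>v (P *\<^sub>v w) = 0\<^sub>v n"
    using eig True w assoc_mult_mat_vec[OF Pc Pc w] by auto
  also have "w \<bullet>c 0\<^sub>v n = 0" using w by (auto simp: scalar_prod_def)
  finally have "P *\<^sub>v w = 0\<^sub>v n" using conjugate_square_eq_0_vec[OF Pw] by simp
  then show ?thesis using True w by auto
next
  case False
  define c where "c = complex_of_real q"
  define u where "u = P *\<^sub>v w - c \<cdot>\<^sub>v w"
  have Pw: "P *\<^sub>v w \<in> carrier_vec n" using Pc w by simp
  have u: "u \<in> carrier_vec n" using Pw w by (simp add: u_def)
  have "P *\<^sub>v u = P *\<^sub>v (P *\<^sub>v w) - c \<cdot>\<^sub>v (P *\<^sub>v w)"
    unfolding u_def using Pc Pw w
    by (simp add: mult_minus_distrib_mat_vec mult_mat_vec[OF Pc w])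
  also have "P *\<^sub>v (P *\<^sub>v w) = (c * c) \<cdot>\<^sub>v w"
    using eig assoc_mult_mat_vec[OF Pc Pc w] by (simp add: c_def power2_eq_square)
  also have "(c * c) \<cdot>\<^sub>v w - c \<cdot>\<^sub>v (P *\<^sub>v w) = (- c) \<cdot>\<^sub>v u"
    unfolding u_def using w Pc by (intro eq_vecI) (auto simp: algebra_simps)
  finally have Pu: "P *\<^sub>v u = (- c) \<cdot>\<^sub>v u" .
  have uu: "0 \<le> u \<bullet>c u" by (rule conjugate_square_ge_0_vec)
  have "(P *\<^sub>v u) \<bullet>c u = - c * (u \<bullet>c u)"
    using u by (simp add: Pu)
  moreover have "0 \<le> Re ((P *\<^sub>v u) \<bullet>c u)"
    using P Pc u by (auto simp: pos_semidef_mat_def)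
  ultimately have "q * Re (u \<bullet>c u) \<le> 0" by (simp add: c_def)
  then have "Re (u \<bullet>c u) \<le> 0" using q False by (simp add: mult_le_0_iff)
  then have "u \<bullet>c u = 0" using uu by (auto simp: less_eq_complex_def complex_eq_iff)
  then have "u = 0\<^sub>v n" using conjugate_square_eq_0_vec[OF u] by simp
  then show ?thesis
    using Pw w Pc unfolding u_def c_def[symmetric] by (auto simp: vec_eq_iff)
qed

text \<open>This contains the uniqueness of the positive semi-definite root of \<open>A\<^sup>* A\<close>: each column of
  \<open>U\<close> is an eigenvector of \<open>P\<^sup>2\<close>, hence of \<open>P\<close> itself.\<close>

lemma polar_factor_unitary_diag:
  assumes U: "unitary_mat U" and P: "is_polar_factor (unitary_diag U l) P"
  shows "P = unitary_diag U (\<lambda>i. complex_of_real (cmod (l i)))"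
proof -
  define n where "n = dim_row U"
  have sq: "P * P = unitary_diag U (\<lambda>i. cnj (l i) * l i)" and psd: "pos_semidef_mat P"
    using P by (auto simp: is_polar_factor_def unitary_diag_adjoint[OF U] unitary_diag_mult[OF U])
  have "dim_row P = n"
    using sq unitary_diag_carrier[OF U n_def[symmetric]] by (metis carrier_matD(1) index_mult_mat(2))
  then have Pc: "P \<in> carrier_mat n n" using psd by (auto simp: pos_semidef_mat_def square_mat.simps)
  show ?thesis
  proof (rule eq_unitary_diagI[OF U])
    show "P \<in> carrier_mat (dim_row U) (dim_row U)" using Pc n_def by simp
    fix j assume j: "j < dim_row U"
    have eig: "(P * P) *\<^sub>v col U j = complex_of_real ((cmod (l j))\<^sup>2) \<cdot>\<^sub>v col U j"
      unfolding sq unitary_diag_mult_col[OF U j]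
      by (simp add: complex_norm_square mult.commute flip: of_real_power)
    have "col U j \<in> carrier_vec n" by (rule carrier_vecI) (simp add: n_def)
    then show "P *\<^sub>v col U j = complex_of_real (cmod (l j)) \<cdot>\<^sub>v col U j"
      by (rule pos_semidef_eigenvector_of_square[OF psd Pc _ norm_ge_zero eig])
  qed
qed

text \<open>The unitary matrix that diagonalises \<open>S\<close> need not be the one given with \<open>A\<close>, so the
  projector \<open>P G\<close> is expressed as \<open>A A\<^sup>+\<close>, which can be computed in any eigenbasis of \<open>A\<close>.\<close>

lemma pinv_normal_sqrt_square:
  assumes A: "A \<in> carrier_mat n n" and S: "is_normal_sqrt A S" and P: "is_polar_factor A P"
  obtains "P \<in> carrier_mat n n" "pinv S \<in> carrier_mat n n"
    "mat_adjoint (pinv S) * pinv S = pinv S * mat_adjoint (pinv S)"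
    "is_pinv P (pinv S * mat_adjoint (pinv S))"
    "P * (pinv S * mat_adjoint (pinv S)) = A * pinv A"
proof -
  obtain U l m where U: "unitary_mat U" and Al: "A = unitary_diag U l"
    and Sm: "S = unitary_diag U m" and sq: "\<And>i. i < dim_row U \<Longrightarrow> (m i)\<^sup>2 = l i"
    using S by (auto simp: is_normal_sqrt_def unitary_diag_def)
  have n: "dim_row U = n" using A unitary_diag_carrier[OF U refl, of l] Al by auto
  have pS: "pinv S = unitary_diag U (\<lambda>i. inverse (m i))"
    unfolding Sm by (intro pinv_eqI is_pinv_unitary_diag U)
  have pA: "pinv A = unitary_diag U (\<lambda>i. inverse (l i))"
    unfolding Al by (intro pinv_eqI is_pinv_unitary_diag U)
  have Pl: "P = unitary_diag U (\<lambda>i. complex_of_real (cmod (l i)))"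
    using polar_factor_unitary_diag[OF U] P Al by simp
  have G: "pinv S * mat_adjoint (pinv S) =
      unitary_diag U (\<lambda>i. inverse (complex_of_real (cmod (l i))))"
    unfolding pS unitary_diag_adjoint[OF U] unitary_diag_mult[OF U]
    by (intro unitary_diag_cong)
       (simp add: sq[symmetric] norm_power complex_norm_square del: of_real_power)
  show thesis
  proof
    show "P \<in> carrier_mat n n" "pinv S \<in> carrier_mat n n"
      using unitary_diag_carrier[OF U n] by (auto simp: Pl pS)
    show "mat_adjoint (pinv S) * pinv S = pinv S * mat_adjoint (pinv S)"
      unfolding pS unitary_diag_adjoint[OF U] unitary_diag_mult[OF U] by (simp add: mult.commute)
    show "is_pinv P (pinv S * mat_adjoint (pinv S))"
      unfolding G unfolding Pl by (rule is_pinv_unitary_diag[OF U])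
    show "P * (pinv S * mat_adjoint (pinv S)) = A * pinv A"
      unfolding G unfolding pA unfolding Pl Al unitary_diag_mult[OF U]
      by (intro unitary_diag_cong) (auto simp: field_simps)
  qed
qed

section \<open>Singular values of the two-sided product\<close>

text \<open>If \<open>M N v = k v\<close>, then \<open>N v\<close> is an eigenvector of \<open>N M\<close> unless it vanishes. If it does
  vanish, then \<open>k = 0\<close> and \<open>N\<close> is singular, and so is \<open>N M\<close>.\<close>

lemma eigenvalue_mult_commute_imp:
  fixes M N :: "complex mat"
  assumes M: "M \<in> carrier_mat n n" and N: "N \<in> carrier_mat n n"
    and ev: "eigenvalue (M * N) k"
  shows "eigenvalue (N * M) k"
proof -
  have MN: "M * N \<in> carrier_mat n n" and NM: "N * M \<in> carrier_mat n n" using M N by auto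
  obtain v where v: "v \<in> carrier_vec n" "v \<noteq> 0\<^sub>v n" "(M * N) *\<^sub>v v = k \<cdot>\<^sub>v v"
    using ev MN by (auto simp: eigenvalue_def eigenvector_def)
  have Nv: "N *\<^sub>v v \<in> carrier_vec n" using N v by simp
  show ?thesis
  proof (cases "N *\<^sub>v v = 0\<^sub>v n")
    case False
    have "(N * M) *\<^sub>v (N *\<^sub>v v) = N *\<^sub>v ((M * N) *\<^sub>v v)"
      using assoc_mult_mat_vec[OF N M Nv] assoc_mult_mat_vec[OF M N v(1)] by simp
    also have "\<dots> = k \<cdot>\<^sub>v (N *\<^sub>v v)" unfolding v(3) by (rule mult_mat_vec[OF N v(1)])
    finally have "eigenvector (N * M) (N *\<^sub>v v) k"
      using False Nv NM N by (auto simp: eigenvector_def)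
    then show ?thesis by (auto simp: eigenvalue_def)
  next
    case True
    have "M *\<^sub>v 0\<^sub>v n = 0\<^sub>v n" using M by (intro eq_vecI) (auto simp: scalar_prod_def)
    then have "k \<cdot>\<^sub>v v = 0\<^sub>v n"
      using v(3) assoc_mult_mat_vec[OF M N v(1)] True by simp
    then have k: "k = 0" using v(1,2) by (auto simp: vec_eq_iff)
    have "det N = 0" using det_0_iff_vec_prod_zero_field[OF N] v True by auto
    then have "det (N * M) = 0" using det_mult[OF N M] by simp
    then obtain w where w: "w \<in> carrier_vec n" "w \<noteq> 0\<^sub>v n" "(N * M) *\<^sub>v w = 0\<^sub>v n"
      using det_0_iff_vec_prod_zero_field[OF NM] by blast
    have "k \<cdot>\<^sub>v w = 0\<^sub>v n" unfolding k using w(1) by (intro eq_vecI) simp_all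
    with w have "eigenvector (N * M) w k"
      unfolding eigenvector_def carrier_matD(1)[OF NM] by simp
    then show ?thesis by (auto simp: eigenvalue_def)
  qed
qed

lemma eigenvalue_mult_commute:
  fixes M N :: "complex mat"
  assumes "M \<in> carrier_mat n n" "N \<in> carrier_mat n n"
  shows "eigenvalue (M * N) k \<longleftrightarrow> eigenvalue (N * M) k"
  using eigenvalue_mult_commute_imp assms by blast

text \<open>Normality of \<open>X\<close> makes the inner factor \<open>X\<^sup>* X\<close> and the outer factor \<open>X X\<^sup>*\<close>, which
  appears after the cyclic shift, the same matrix \<open>G\<close>.\<close>

lemma singular_values_sandwich:
  fixes X E :: "complex mat"
  assumes X: "X \<in> carrier_mat n n" and E: "E \<in> carrier_mat n n"
    and normal: "mat_adjoint X * X = X * mat_adjoint X"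
  defines "G \<equiv> X * mat_adjoint X"
  shows "singular_values (X * E * X) =
    {s. 0 \<le> s \<and> eigenvalue (G * mat_adjoint E * (G * E)) (complex_of_real (s\<^sup>2))}"
proof -
  note assoc = assoc_mult_mat[where ?n\<^sub>1.0 = n and ?n\<^sub>2.0 = n and ?n\<^sub>3.0 = n and ?n\<^sub>4.0 = n]
  note carr = mult_carrier_mat[where nr = n and n = n and nc = n]
  have c: "mat_adjoint X \<in> carrier_mat n n" "mat_adjoint E \<in> carrier_mat n n"
    using X E by (auto intro: mat_adjoint_carrier)
  have "mat_adjoint (X * E * X) * (X * E * X) =
      (mat_adjoint X * (mat_adjoint E * ((mat_adjoint X * X) * E))) * X"
    using X E c by (simp add: mat_adjoint_mult[of _ n n _ n] assoc carr)
  then have "eigenvalue (mat_adjoint (X * E * X) * (X * E * X)) k \<longleftrightarrow>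
      eigenvalue (X * (mat_adjoint X * (mat_adjoint E * ((mat_adjoint X * X) * E)))) k" for k
    using X E c by (simp add: eigenvalue_mult_commute[of _ n])
  moreover have "X * (mat_adjoint X * (mat_adjoint E * ((mat_adjoint X * X) * E))) =
      G * mat_adjoint E * (G * E)"
    unfolding normal G_def using X E c by (simp add: assoc carr)
  ultimately show ?thesis by (simp add: singular_values_def)
qed

section \<open>Congruence transformations\<close>

lemma invertible_mat_obtain_inverse:
  fixes D :: "complex mat"
  assumes D: "D \<in> carrier_mat n n" and inv: "invertible_mat D"
  obtains Di where "D * Di = 1\<^sub>m n" "Di * D = 1\<^sub>m n" "Di \<in> carrier_mat n n"
proof -
  obtain Di where 1: "D * Di = 1\<^sub>m n" and 2: "Di * D = 1\<^sub>m (dim_row Di)"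
    using inv D by (auto simp: invertible_mat_def inverts_mat_def)
  have "dim_col Di = n" using arg_cong[OF 1, of dim_col] by simp
  moreover have "dim_row Di = n" using arg_cong[OF 2, of dim_col] D by simp
  ultimately show thesis using that 1 2 by auto
qed

text \<open>The candidate satisfies the two algebraic Penrose conditions by cancellation. The products
  in the two Hermitian conditions are \<open>D (P G) D\<^sup>-\<^sup>1\<close> and \<open>D\<^sup>-\<^sup>* (P G) D\<^sup>*\<close>, which are adjoint
  to each other; they coincide exactly because \<open>D\<^sup>* D\<close> commutes with \<open>P G\<close>.\<close>

lemma is_pinv_congruence:
  fixes D Di P G :: "complex mat"
  assumes P: "P \<in> carrier_mat n n" and D: "D \<in> carrier_mat n n" and Di: "Di \<in> carrier_mat n n"
    and inv: "D * Di = 1\<^sub>m n" "Di * D = 1\<^sub>m n"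
    and herm: "mat_adjoint P = P" "mat_adjoint G = G"
    and pinv: "is_pinv P G"
    and comm: "(mat_adjoint D * D) * (P * G) = (P * G) * (mat_adjoint D * D)"
  shows "is_pinv (D * P * mat_adjoint D) (mat_adjoint Di * G * Di)"
proof -
  note assoc = assoc_mult_mat[where ?n\<^sub>1.0 = n and ?n\<^sub>2.0 = n and ?n\<^sub>3.0 = n and ?n\<^sub>4.0 = n]
  note carr = mult_carrier_mat[where nr = n and n = n and nc = n]
  note adj = mat_adjoint_mult[where m = n and n = n and k = n]
  let ?D = "mat_adjoint D" and ?Di = "mat_adjoint Di"
  have G: "G \<in> carrier_mat n n" using pinv P by (auto simp: is_pinv_def)
  have c: "?D \<in> carrier_mat n n" "?Di \<in> carrier_mat n n"
    using D Di by (auto intro: mat_adjoint_carrier)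
  note cc = P G D Di c
  have inv': "?D * ?Di = 1\<^sub>m n" "?Di * ?D = 1\<^sub>m n"
    by (rule adj[OF Di D, unfolded inv mat_adjoint_one, symmetric],
        rule adj[OF D Di, unfolded inv mat_adjoint_one, symmetric])
  have cancel: "D * (Di * Y) = Y" "Di * (D * Y) = Y" "?D * (?Di * Y) = Y" "?Di * (?D * Y) = Y"
    if Y: "Y \<in> carrier_mat n n" for Y
    using assoc[OF D Di Y] assoc[OF Di D Y] assoc[OF c(1,2) Y] assoc[OF c(2,1) Y] inv inv' Y
    by simp_all
  have pin: "P * G * P = P" "G * P * G = G" using pinv by (auto simp: is_pinv_def)
  have "G * P = mat_adjoint (P * G)" using adj[OF P G] herm by simp
  also have "\<dots> = P * G" using pinv by (simp add: is_pinv_def)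
  finally have GP: "G * P = P * G" .
  have pin': "P * (G * P) = P" "G * (P * G) = G"
    using pin cc by (simp_all add: assoc carr)
  have PX: "(D * P * ?D) * (?Di * G * Di) = D * (P * G) * Di"
    using cc by (simp add: assoc carr cancel)
  have XP: "(?Di * G * Di) * (D * P * ?D) = ?Di * (P * G) * ?D"
    using cc by (simp add: assoc carr cancel GP[symmetric])
  have "D * (P * G) * Di = ?Di * ((?D * D) * (P * G)) * Di"
    using cc by (simp add: assoc carr cancel)
  also have "\<dots> = ?Di * (P * G) * ?D"
    unfolding comm using cc by (simp add: assoc carr cancel inv)
  finally have eq: "D * (P * G) * Di = ?Di * (P * G) * ?D" .
  have h1: "mat_adjoint (D * (P * G) * Di) = ?Di * (P * G) * ?D"
    using cc by (simp add: adj herm GP assoc carr)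
  have h2: "mat_adjoint (?Di * (P * G) * ?D) = D * (P * G) * Di"
    using cc by (simp add: adj herm GP assoc carr)
  have PXP: "(D * (P * G) * Di) * (D * P * ?D) = D * P * ?D"
  proof -
    have "(D * (P * G) * Di) * (D * P * ?D) = D * (P * (G * P)) * ?D"
      using cc by (simp add: assoc carr cancel)
    then show ?thesis by (simp only: pin')
  qed
  have "(?Di * (G * P) * ?D) * (?Di * G * Di) = ?Di * (G * (P * G)) * Di"
    using cc by (simp add: assoc carr cancel)
  then have XPX: "(?Di * (P * G) * ?D) * (?Di * G * Di) = ?Di * G * Di"
    by (simp only: GP pin')
  have "?Di * G * Di \<in> carrier_mat (dim_col (D * P * ?D)) (dim_row (D * P * ?D))"
    using cc by (auto simp: carr)
  moreover have "mat_adjoint (D * (P * G) * Di) = D * (P * G) * Di"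
    using h1 eq by simp
  moreover have "mat_adjoint (?Di * (P * G) * ?D) = ?Di * (P * G) * ?D"
    using h2 eq by simp
  ultimately show ?thesis
    unfolding is_pinv_def PX XP PXP XPX by blast
qed

section \<open>Invariance of the scaled norm under congruence\<close>

theorem theorem3p1:
  fixes n r :: nat
    and A V P E D A' P' E' S S' :: "complex mat"
  assumes "A \<in> carrier_mat n n" and "normal_mat A"
    and "vec_space.rank n A = r" and "r \<le> n"
    and "is_eigenvector_matrix A r V"
    and "is_polar_factor A P"
    and "E \<in> carrier_mat n n"
    and "D \<in> carrier_mat n n" and "invertible_mat D"
    and "(mat_adjoint D * D) * (first_cols r V * mat_adjoint (first_cols r V)) =
         (first_cols r V * mat_adjoint (first_cols r V)) * (mat_adjoint D * D)"
    and "A' \<in> carrier_mat n n" and "normal_mat A'"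
    and "is_polar_factor A' P'" and "P' = D * P * mat_adjoint D"
    and "E' = D * E * mat_adjoint D"
    and "is_normal_sqrt A S" and "is_normal_sqrt A' S'"
  shows "norm2_mat (pinv S * E * pinv S) = norm2_mat (pinv S' * E' * pinv S')"
proof -
  note assoc = assoc_mult_mat[where ?n\<^sub>1.0 = n and ?n\<^sub>2.0 = n and ?n\<^sub>3.0 = n and ?n\<^sub>4.0 = n]
  note carr = mult_carrier_mat[where nr = n and n = n and nc = n]
  define X X' G G' where "X = pinv S" and "X' = pinv S'"
    and "G = X * mat_adjoint X" and "G' = X' * mat_adjoint X'"
  have P: "P \<in> carrier_mat n n" and X: "X \<in> carrier_mat n n"
    and Xn: "mat_adjoint X * X = X * mat_adjoint X"
    and PG: "is_pinv P G" and proj: "P * G = A * pinv A"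
    unfolding X_def G_def using pinv_normal_sqrt_square[OF assms(1,16,6)] by blast+
  have X': "X' \<in> carrier_mat n n"
    and Xn': "mat_adjoint X' * X' = X' * mat_adjoint X'"
    and PG': "is_pinv P' G'"
    unfolding X'_def G'_def using pinv_normal_sqrt_square[OF assms(11,17,13)] by blast+
  have E: "E \<in> carrier_mat n n" and D: "D \<in> carrier_mat n n" by fact+
  obtain Di where inv: "D * Di = 1\<^sub>m n" "Di * D = 1\<^sub>m n" and Di: "Di \<in> carrier_mat n n"
    using invertible_mat_obtain_inverse[OF D assms(9)] .
  have PG_V: "P * G = first_cols r V * mat_adjoint (first_cols r V)"
  proof -
    obtain l where V: "unitary_mat V" and Al: "A = unitary_diag V l"
      and l: "\<And>i. i < dim_row V \<Longrightarrow> l i \<noteq> 0 \<longleftrightarrow> i < r"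
      using assms(5) by (auto simp: is_eigenvector_matrix_def unitary_diag_def)
    have dV: "dim_row V = n" using assms(1) unitary_diag_carrier[OF V refl, of l] Al by auto
    have "A * pinv A = unitary_diag V (\<lambda>i. l i * inverse (l i))"
      unfolding Al pinv_eqI[OF is_pinv_unitary_diag[OF V]] by (rule unitary_diag_mult[OF V])
    also have "\<dots> = unitary_diag V (\<lambda>i. if i < r then 1 else 0)"
      using l by (intro unitary_diag_cong) auto
    also have "\<dots> = first_cols r V * mat_adjoint (first_cols r V)"
      using first_cols_mult_adjoint[OF V] assms(4) dV by simp
    finally show ?thesis using proj by simp
  qed
  have Xa: "mat_adjoint X \<in> carrier_mat n n" "mat_adjoint X' \<in> carrier_mat n n"
    and Ea: "mat_adjoint E \<in> carrier_mat n n" and Da: "mat_adjoint D \<in> carrier_mat n n"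
    and Dia: "mat_adjoint Di \<in> carrier_mat n n"
    using X X' E D Di by (auto intro: mat_adjoint_carrier)
  have G: "G \<in> carrier_mat n n" and G': "G' \<in> carrier_mat n n"
    using X X' Xa by (auto simp: G_def G'_def)
  have "is_pinv P' (mat_adjoint Di * G * Di)"
    unfolding assms(14)
  proof (rule is_pinv_congruence[OF P D Di inv _ _ PG])
    show "mat_adjoint P = P" using assms(6) by (auto simp: is_polar_factor_def pos_semidef_mat_def)
    show "mat_adjoint G = G" unfolding G_def using mat_adjoint_mult[OF X Xa(1)] by simp
    show "(mat_adjoint D * D) * (P * G) = (P * G) * (mat_adjoint D * D)"
      unfolding PG_V by (rule assms(10))
  qed
  then have G'_eq: "G' = mat_adjoint Di * G * Di" using PG' is_pinv_unique by blast
  have inv': "mat_adjoint D * mat_adjoint Di = 1\<^sub>m n"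
    using mat_adjoint_mult[OF Di D] inv by simp
  have "mat_adjoint D * G' * D = (mat_adjoint D * mat_adjoint Di) * (G * (Di * D))"
    unfolding G'_eq using G Di D Da Dia by (simp add: assoc carr)
  then have DGD: "mat_adjoint D * G' * D = G" using inv inv' G by simp
  have E': "E' \<in> carrier_mat n n" unfolding assms(15) using D E Da by auto
  have E'a: "mat_adjoint E' = D * mat_adjoint E * mat_adjoint D"
    unfolding assms(15) using D E Da Ea by (simp add: mat_adjoint_mult[of _ n n _ n] assoc carr)
  have "eigenvalue (G' * mat_adjoint E' * (G' * E')) k \<longleftrightarrow>
      eigenvalue (G * mat_adjoint E * (G * E)) k" for k
  proof -
    \<comment> \<open>The right-hand factor \<open>mat_adjoint D\<close> of \<open>E'\<close> is the one that is moved to the front.\<close>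
    let ?M = "G' * (D * (mat_adjoint E * ((mat_adjoint D * G' * D) * E)))"
    have "G' * mat_adjoint E' * (G' * E') = ?M * mat_adjoint D"
      unfolding E'a unfolding assms(15) using G' D E Da Ea by (simp add: assoc carr)
    moreover have "eigenvalue (?M * mat_adjoint D) k \<longleftrightarrow> eigenvalue (mat_adjoint D * ?M) k"
      using G' D E Da Ea by (intro eigenvalue_mult_commute[OF _ Da]) (simp add: carr)
    moreover have "mat_adjoint D * ?M =
        (mat_adjoint D * G' * D) * mat_adjoint E * ((mat_adjoint D * G' * D) * E)"
      using G' D E Da Ea by (simp add: assoc carr)
    ultimately show ?thesis unfolding DGD by simp
  qed
  then have "singular_values (X * E * X) = singular_values (X' * E' * X')"
    using singular_values_sandwich[OF X E Xn] singular_values_sandwich[OF X' E' Xn']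
    by (simp add: G_def G'_def)
  then show ?thesis by (simp add: norm2_mat_def X_def X'_def)
qed

end
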